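(* Let $\ell>0$ and integers $m\ge n\ge 1$. Let $R=\{r_1,\ldots,r_n\}$ (riders) and $D=\{d_1,\ldots,d_m\}$ (drivers) be independent uniform random points on $[0,\ell]$ ($\ell$ may depend on $n,m$). Let $cost(OMN)$ denote the minimum, over all injective maps $\sigma:\{1,\ldots,n\}\to\{1,\ldots,m\}$, of $\sum_{i=1}^n |r_i-d_{\sigma(i)}|$. Then: (1) (Balanced market) There exists a constant $C>0$ such that for all $n\ge 1$, if $m=n$ then $\mathbb{E}[cost(OMN)]\ge C\ell\sqrt{n}$. (2) (Unbalanced market) For every $\epsilon>0$ there exists a constant $C_\epsilon>0$ such that for all $n\ge 4\epsilon^{-1}$ and all $m\ge(1+\epsilon)n$, $\mathbb{E}[cost(OMN)]\le C_\epsilon \ell$. The expectations are over the randomness of $R$ and $D$.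
   Context: $cost(OMN)$ is the cost of the "omniscient" matching: the value of the integer program minimizing $\sum_{i,j}x_{ij}|r_i-d_j|$ subject to every rider being matched to exactly one driver and every driver matched to at most one rider, $x_{ij}\in\{0,1\}$. The constants do not depend on $n$ or $\ell$. *)

theory Defs
  imports "HOL-Probability.Probability"
begin

definition matchings :: "nat \<Rightarrow> nat \<Rightarrow> (nat \<Rightarrow> nat) set" where
  "matchings n m = {\<sigma> \<in> {1..n} \<rightarrow>\<^sub>E {1..m}. inj_on \<sigma> {1..n}}"

text \<open>The minimum is over a finite set of values, which is nonempty exactly when \<open>n \<le> m\<close>.\<close>

definition cost_OMN :: "nat \<Rightarrow> nat \<Rightarrow> (nat \<Rightarrow> real) \<Rightarrow> (nat \<Rightarrow> real) \<Rightarrow> real" where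
  "cost_OMN n m r d = (MIN \<sigma>\<in>matchings n m. \<Sum>i=1..n. \<bar>r i - d (\<sigma> i)\<bar>)"

text \<open>
  The joint law of the \<open>n + m\<close> independent uniform points on \<open>[0, l]\<close>: the coordinate \<open>Inl i\<close> is
  rider \<open>i\<close>, the coordinate \<open>Inr j\<close> is driver \<open>j\<close>. Working with the law itself, rather than with
  random variables on an arbitrary probability space, keeps the constants of the theorem from
  depending on the type of the sample space; the lemma \<open>expectation_cost_OMN\<close> below transfers
  expectations to any such space.
\<close>

definition market :: "real \<Rightarrow> nat \<Rightarrow> nat \<Rightarrow> (nat + nat \<Rightarrow> real) measure" where
  "market l n m = (\<Pi>\<^sub>M k\<in>{1..n} <+> {1..m}. uniform_measure lborel {0..l})"

definition expected_cost_OMN :: "real \<Rightarrow> nat \<Rightarrow> nat \<Rightarrow> real" where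
  "expected_cost_OMN l n m =
     (\<integral>\<omega>. cost_OMN n m (\<lambda>i. \<omega> (Inl i)) (\<lambda>j. \<omega> (Inr j)) \<partial>market l n m)"

lemma finite_matchings: "finite (matchings n m)"
  unfolding matchings_def
  by (rule finite_subset[OF _ finite_PiE[of "{1..n}" "\<lambda>_. {1..m}"]]) auto

lemma matchings_nonempty:
  assumes "n \<le> m"
  shows "matchings n m \<noteq> {}"
proof -
  have "restrict id {1..n} \<in> matchings n m"
    using assms by (auto simp: matchings_def inj_on_def)
  thus ?thesis by blast
qed

lemma matchings_range: "\<sigma> \<in> matchings n m \<Longrightarrow> i \<in> {1..n} \<Longrightarrow> \<sigma> i \<in> {1..m}"
  by (auto simp: matchings_def)

lemma prob_space_uniform_Icc:
  assumes "0 < (l::real)"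
  shows "prob_space (uniform_measure lborel {0..l})"
  using assms by (intro prob_space_uniform_measure) auto

lemma prob_space_market:
  assumes "0 < l"
  shows "prob_space (market l n m)"
  unfolding market_def by (intro prob_space_PiM prob_space_uniform_Icc assms)

lemma measurable_cost_OMN:
  "(\<lambda>\<omega>. cost_OMN n m (\<lambda>i. \<omega> (Inl i)) (\<lambda>j. \<omega> (Inr j)))
     \<in> borel_measurable (\<Pi>\<^sub>M k\<in>{1..n} <+> {1..m}. (borel :: real measure))"
  unfolding cost_OMN_def
proof (rule borel_measurable_Min[OF finite_matchings])
  fix \<sigma> assume \<sigma>: "\<sigma> \<in> matchings n m"
  show "(\<lambda>\<omega>. \<Sum>i=1..n. \<bar>\<omega> (Inl i) - \<omega> (Inr (\<sigma> i))\<bar>)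
     \<in> borel_measurable (\<Pi>\<^sub>M k\<in>{1..n} <+> {1..m}. (borel :: real measure))"
    using matchings_range[OF \<sigma>]
    by (intro borel_measurable_sum borel_measurable_abs borel_measurable_diff
          measurable_component_singleton) auto
qed

lemma sets_market:
  "sets (market l n m) = sets (\<Pi>\<^sub>M k\<in>{1..n} <+> {1..m}. (borel :: real measure))"
  unfolding market_def by (intro sets_PiM_cong) auto

lemma cost_OMN_bounds:
  assumes "n \<le> m"
    and r: "\<And>i. i \<in> {1..n} \<Longrightarrow> r i \<in> {0..l}"
    and d: "\<And>j. j \<in> {1..m} \<Longrightarrow> d j \<in> {0..l}"
  shows "cost_OMN n m r d \<in> {0..n * l}"
proof -
  have "cost_OMN n m r d \<in> (\<lambda>\<sigma>. \<Sum>i=1..n. \<bar>r i - d (\<sigma> i)\<bar>) ` matchings n m"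
    unfolding cost_OMN_def
    using finite_matchings matchings_nonempty[OF assms(1)] by (intro Min_in) auto
  then obtain \<sigma> where \<sigma>: "\<sigma> \<in> matchings n m"
    and eq: "cost_OMN n m r d = (\<Sum>i=1..n. \<bar>r i - d (\<sigma> i)\<bar>)" by blast
  have "\<bar>r i - d (\<sigma> i)\<bar> \<le> l" if "i \<in> {1..n}" for i
    using r[OF that] d[OF matchings_range[OF \<sigma> that]] by auto
  hence "(\<Sum>i=1..n. \<bar>r i - d (\<sigma> i)\<bar>) \<le> (\<Sum>i=1..n. l)" by (intro sum_mono)
  thus ?thesis by (simp add: eq sum_nonneg)
qed

lemma integrable_cost_OMN:
  assumes "0 < l" "n \<le> m"
  shows "integrable (market l n m) (\<lambda>\<omega>. cost_OMN n m (\<lambda>i. \<omega> (Inl i)) (\<lambda>j. \<omega> (Inr j)))"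
proof -
  interpret prob_space "market l n m" by (rule prob_space_market[OF assms(1)])
  have "AE \<omega> in market l n m. \<omega> k \<in> {0..l}" if "k \<in> {1..n} <+> {1..m}" for k
    unfolding market_def
  proof (rule AE_PiM_component)
    show "AE x in uniform_measure lborel {0..l}. x \<in> {0..l}"
      using assms by (intro AE_uniform_measureI) auto
  qed (use that assms in \<open>auto intro!: prob_space_uniform_Icc\<close>)
  hence ae: "AE \<omega> in market l n m. \<forall>k\<in>{1..n} <+> {1..m}. \<omega> k \<in> {0..l}"
    by (intro AE_finite_allI) auto
  show ?thesis
  proof (rule integrable_const_bound[where B = "n * l"])
    show "AE \<omega> in market l n m.
            norm (cost_OMN n m (\<lambda>i. \<omega> (Inl i)) (\<lambda>j. \<omega> (Inr j))) \<le> n * l"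
      using ae
    proof eventually_elim
      case (elim \<omega>)
      have "cost_OMN n m (\<lambda>i. \<omega> (Inl i)) (\<lambda>j. \<omega> (Inr j)) \<in> {0..n * l}"
        using elim by (intro cost_OMN_bounds assms) auto
      thus ?case by auto
    qed
    show "(\<lambda>\<omega>. cost_OMN n m (\<lambda>i. \<omega> (Inl i)) (\<lambda>j. \<omega> (Inr j)))
            \<in> borel_measurable (market l n m)"
      using measurable_cost_OMN measurable_cong_sets[OF sets_market refl] by blast
  qed
qed

lemma (in prob_space) expectation_cost_OMN:
  fixes r d :: "nat \<Rightarrow> 'a \<Rightarrow> real"
  assumes "1 \<le> n"
    and indep: "indep_vars (\<lambda>_. borel) (case_sum r d) ({1..n} <+> {1..m})"
    and r: "\<And>i. i \<in> {1..n} \<Longrightarrow> distr M borel (r i) = uniform_measure lborel {0..l}"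
    and d: "\<And>j. j \<in> {1..m} \<Longrightarrow> distr M borel (d j) = uniform_measure lborel {0..l}"
  shows "expectation (\<lambda>\<omega>. cost_OMN n m (\<lambda>i. r i \<omega>) (\<lambda>j. d j \<omega>)) = expected_cost_OMN l n m"
proof -
  let ?I = "{1..n} <+> {1..m}"
  let ?X = "case_sum r d"
  let ?P = "\<Pi>\<^sub>M k\<in>?I. (borel :: real measure)"
  let ?f = "\<lambda>\<omega>. cost_OMN n m (\<lambda>i. \<omega> (Inl i)) (\<lambda>j. \<omega> (Inr j))"
  have rv: "random_variable borel (?X k)" if "k \<in> ?I" for k
    using indep that by (simp add: indep_vars_def)
  have "Inl 1 \<in> ?I" using assms(1) by auto
  hence ne: "?I \<noteq> {}" by blast
  have "distr M ?P (\<lambda>x. \<lambda>k\<in>?I. ?X k x) = (\<Pi>\<^sub>M k\<in>?I. distr M borel (?X k))"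
    using indep_vars_iff_distr_eq_PiM'[OF ne, where M' = "\<lambda>_. borel" and X = ?X] rv indep by blast
  also have "\<dots> = market l n m"
    unfolding market_def using r d by (intro PiM_cong) auto
  finally have law: "market l n m = distr M ?P (\<lambda>x. \<lambda>k\<in>?I. ?X k x)" by simp
  have "expected_cost_OMN l n m = expectation (\<lambda>x. ?f (\<lambda>k\<in>?I. ?X k x))"
    unfolding expected_cost_OMN_def law
    by (rule integral_distr[OF _ measurable_cost_OMN]) (intro measurable_restrict rv)
  also have "(\<lambda>x. ?f (\<lambda>k\<in>?I. ?X k x)) = (\<lambda>\<omega>. cost_OMN n m (\<lambda>i. r i \<omega>) (\<lambda>j. d j \<omega>))"
  proof
    fix x
    show "?f (\<lambda>k\<in>?I. ?X k x) = cost_OMN n m (\<lambda>i. r i x) (\<lambda>j. d j x)"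
      unfolding cost_OMN_def
      by (intro arg_cong[where f = Min] image_cong sum.cong refl)
         (use matchings_range in \<open>fastforce\<close>)
  qed
  finally show ?thesis by simp
qed

end

theory Submission
  imports Defs
begin

text \<open>
  Lower bound. For \<open>m = n\<close> a matching is a permutation, so its cost is at least \<open>\<bar>S\<bar>\<close>, where
  \<open>S = (\<Sum>i. r i) - (\<Sum>j. d j)\<close> is a signed sum of \<open>2n\<close> independent centred variables of variance
  \<open>l\<^sup>2 / 12\<close>. The characteristic function of each is at most \<open>exp (- t\<^sup>2 l\<^sup>2 / 36)\<close> in modulus for
  \<open>0 < t \<le> 2 / l\<close>, and \<open>t * E \<bar>S\<bar>\<close> is at least one minus the modulus of the characteristic function
  of \<open>S\<close> at \<open>t\<close>; take \<open>t = 2 / (l \<surd>n)\<close>.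

  Upper bound. Cut \<open>[0, l)\<close> into \<open>n\<close> buckets of width \<open>l / n\<close> and scan them from left to right,
  letting the drivers of a bucket serve riders who wait in a queue. A rider travels \<open>l / n\<close> per
  bucket spent in the queue, plus at most \<open>l / n\<close>; those left over at the end travel at most \<open>l\<close>.
  The queue length before bucket \<open>b\<close> is the excess of riders over drivers in the buckets from some
  \<open>a\<close> to \<open>b - 1\<close>. Drivers outnumber riders by the factor \<open>1 + \<epsilon>\<close>, so a Chernoff bound makes the
  contribution of each \<open>a\<close> exponentially small in \<open>b - a\<close>, and the expected queue length is bounded
  by a constant depending only on \<open>\<epsilon>\<close>.
\<close>

section \<open>Queues\<close>

primrec queue :: "(nat \<Rightarrow> nat) \<Rightarrow> (nat \<Rightarrow> nat) \<Rightarrow> nat \<Rightarrow> nat" where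
  "queue R D 0 = 0"
| "queue R D (Suc b) = queue R D b + R b - D b"

lemma queue_eq_excess:
  "\<exists>a\<le>b. queue R D b + sum D {a..<b} = sum R {a..<b}"
proof (induction b)
  case 0
  show ?case by simp
next
  case (Suc b)
  then obtain a where "a \<le> b" and excess: "queue R D b + sum D {a..<b} = sum R {a..<b}" by blast
  show ?case
  proof (cases "queue R D b + R b \<le> D b")
    case True
    thus ?thesis by (intro exI[of _ "Suc b"]) simp
  next
    case False
    thus ?thesis using \<open>a \<le> b\<close> excess by (intro exI[of _ a]) simp
  qed
qed

lemma queue_le_sum_power:
  fixes z :: real
  assumes "1 < z"
  shows "real (queue R D b) \<le> (\<Sum>a<b. z ^ sum R {a..<b} * (1 / z) ^ sum D {a..<b}) / (z - 1)"
proof -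
  let ?weight = "\<lambda>a. z ^ sum R {a..<b} * (1 / z) ^ sum D {a..<b}"
  have weight_nonneg: "0 \<le> ?weight a" for a using assms by simp
  obtain a where "a \<le> b" and excess: "queue R D b + sum D {a..<b} = sum R {a..<b}"
    using queue_eq_excess by blast
  show ?thesis
  proof (cases "a = b")
    case True
    thus ?thesis using excess assms weight_nonneg by (simp add: sum_nonneg)
  next
    case False
    let ?q = "queue R D b"
    have "1 + real ?q * (z - 1) \<le> (1 + (z - 1)) ^ ?q"
      using assms by (intro Bernoulli_inequality) simp
    hence "real ?q * (z - 1) \<le> z ^ ?q" by simp
    also have "\<dots> = ?weight a"
      using assms by (simp flip: excess add: power_add power_one_over)
    also have "\<dots> \<le> sum ?weight {..<b}"
      using \<open>a \<le> b\<close> False weight_nonneg by (intro member_le_sum) auto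
    finally show ?thesis using assms by (simp add: pos_le_divide_eq)
  qed
qed

definition occupancy :: "'a set \<Rightarrow> ('a \<Rightarrow> nat) \<Rightarrow> nat \<Rightarrow> nat" where
  "occupancy I \<beta> b = card {i \<in> I. \<beta> i = b}"

lemma sum_occupancy:
  assumes "finite I" "finite B"
  shows "sum (occupancy I \<beta>) B = card {i \<in> I. \<beta> i \<in> B}"
proof -
  have "sum (occupancy I \<beta>) B = card (\<Union>b\<in>B. {i \<in> I. \<beta> i = b})"
    unfolding occupancy_def using assms by (intro card_UN_disjoint[symmetric]) auto
  also have "(\<Union>b\<in>B. {i \<in> I. \<beta> i = b}) = {i \<in> I. \<beta> i \<in> B}" by blast
  finally show ?thesis .
qed

lemma power_sum_occupancy:
  fixes z :: "'b :: comm_monoid_mult"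
  assumes "finite I" "finite B"
  shows "z ^ sum (occupancy I \<beta>) B = (\<Prod>i\<in>I. if \<beta> i \<in> B then z else 1)"
  using assms by (simp add: sum_occupancy prod.If_cases Int_def)

text \<open>
  Customer \<open>i\<close> arrives at time \<open>\<beta> i\<close> and is served at time \<open>\<tau> i\<close>, where any \<open>\<tau> i \<ge> N\<close> stands for not
  served before the horizon \<open>N\<close>. One who arrives at time \<open>b\<close> is present, but not yet waiting, at \<open>b\<close>.
\<close>

definition waiting :: "'a set \<Rightarrow> ('a \<Rightarrow> nat) \<Rightarrow> ('a \<Rightarrow> nat) \<Rightarrow> nat \<Rightarrow> 'a set" where
  "waiting I \<beta> \<tau> b = {i \<in> I. \<beta> i < b \<and> b \<le> \<tau> i}"

definition present :: "'a set \<Rightarrow> ('a \<Rightarrow> nat) \<Rightarrow> ('a \<Rightarrow> nat) \<Rightarrow> nat \<Rightarrow> 'a set" where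
  "present I \<beta> \<tau> b = {i \<in> I. \<beta> i \<le> b \<and> b \<le> \<tau> i}"

lemma card_present:
  assumes "finite I" "\<And>i. i \<in> I \<Longrightarrow> \<beta> i \<le> \<tau> i"
  shows "card (present I \<beta> \<tau> b) = card (waiting I \<beta> \<tau> b) + occupancy I \<beta> b"
proof -
  have "present I \<beta> \<tau> b = waiting I \<beta> \<tau> b \<union> {i \<in> I. \<beta> i = b}"
    using assms(2) by (auto simp: waiting_def present_def)
  moreover have "waiting I \<beta> \<tau> b \<inter> {i \<in> I. \<beta> i = b} = {}" by (auto simp: waiting_def)
  ultimately show ?thesis using assms(1) by (simp add: card_Un_disjoint occupancy_def waiting_def)
qed

lemma ex_schedule_postponing:
  assumes after: "\<And>i. i \<in> I \<Longrightarrow> \<beta> i \<le> \<tau> i" and P: "P \<subseteq> present I \<beta> \<tau> N"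
  shows "\<exists>\<tau>'. (\<forall>i\<in>I. \<beta> i \<le> \<tau>' i) \<and> {i \<in> I. \<tau>' i = N} = P \<and>
    (\<forall>c<N. {i \<in> I. \<tau>' i = c} = {i \<in> I. \<tau> i = c}) \<and>
    (\<forall>b\<le>N. waiting I \<beta> \<tau>' b = waiting I \<beta> \<tau> b) \<and>
    waiting I \<beta> \<tau>' (Suc N) = present I \<beta> \<tau> N - P"
proof -
  define \<tau>' where
    "\<tau>' = (\<lambda>i. if i \<in> P then N else if i \<in> present I \<beta> \<tau> N then Suc N else \<tau> i)"
  have present_subset: "present I \<beta> \<tau> N \<subseteq> I" by (auto simp: present_def)
  have \<tau>'_cases: "i \<in> P \<and> \<beta> i \<le> N \<and> N \<le> \<tau> i \<and> \<tau>' i = N \<or>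
      i \<notin> P \<and> \<beta> i \<le> N \<and> N \<le> \<tau> i \<and> \<tau>' i = Suc N \<or>
      i \<notin> P \<and> (N < \<beta> i \<or> \<tau> i < N) \<and> \<tau>' i = \<tau> i" if "i \<in> I" for i
    using that P unfolding \<tau>'_def present_def by auto
  have "\<beta> i \<le> \<tau>' i" "\<tau>' i = N \<longleftrightarrow> i \<in> P" if "i \<in> I" for i
    using \<tau>'_cases[OF that] after[OF that] by linarith+
  moreover have "\<tau>' i = c \<longleftrightarrow> \<tau> i = c" if "i \<in> I" "c < N" for i c
    using \<tau>'_cases[OF that(1)] that(2) by linarith
  moreover have "b \<le> \<tau>' i \<longleftrightarrow> b \<le> \<tau> i" if "i \<in> I" "b \<le> N" for i b
    using \<tau>'_cases[OF that(1)] that(2) by linarith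
  moreover have "\<beta> i < Suc N \<and> Suc N \<le> \<tau>' i \<longleftrightarrow> i \<in> present I \<beta> \<tau> N - P" if "i \<in> I" for i
    using \<tau>'_cases[OF that] that by (auto simp: present_def)
  hence "waiting I \<beta> \<tau>' (Suc N) = present I \<beta> \<tau> N - P"
    unfolding waiting_def using present_subset by blast
  moreover have "P \<subseteq> I" using P present_subset by blast
  ultimately show ?thesis
    unfolding waiting_def by (intro exI[of _ \<tau>']) blast
qed

lemma ex_schedule_waiting_eq_queue:
  fixes I :: "'a set" and \<beta> :: "'a \<Rightarrow> nat"
  assumes "finite I"
  shows "\<exists>\<tau>. (\<forall>i\<in>I. \<beta> i \<le> \<tau> i) \<and> (\<forall>c<N. occupancy I \<tau> c \<le> D c) \<and>
    (\<forall>b\<le>N. card (waiting I \<beta> \<tau> b) = queue (occupancy I \<beta>) D b)"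
proof (induction N)
  case 0
  show ?case by (intro exI[of _ \<beta>]) (auto simp: waiting_def)
next
  case (Suc N)
  obtain \<tau> where after: "\<And>i. i \<in> I \<Longrightarrow> \<beta> i \<le> \<tau> i"
    and served: "\<And>c. c < N \<Longrightarrow> occupancy I \<tau> c \<le> D c"
    and queue: "\<And>b. b \<le> N \<Longrightarrow> card (waiting I \<beta> \<tau> b) = queue (occupancy I \<beta>) D b"
    using Suc.IH by blast
  let ?W = "present I \<beta> \<tau> N"
  have card_present_N: "card ?W = queue (occupancy I \<beta>) D N + occupancy I \<beta> N"
    using card_present[OF assms after] queue by simp
  obtain P where "P \<subseteq> ?W" and card_P: "card P = min (card ?W) (D N)"
    by (meson min.cobounded1 obtain_subset_with_card_n)
  obtain \<tau>' where after': "\<forall>i\<in>I. \<beta> i \<le> \<tau>' i" and served_N: "{i \<in> I. \<tau>' i = N} = P"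
    and served_before: "\<forall>c<N. {i \<in> I. \<tau>' i = c} = {i \<in> I. \<tau> i = c}"
    and waiting_before: "\<forall>b\<le>N. waiting I \<beta> \<tau>' b = waiting I \<beta> \<tau> b"
    and postponed: "waiting I \<beta> \<tau>' (Suc N) = ?W - P"
    using ex_schedule_postponing[OF after \<open>P \<subseteq> ?W\<close>] by blast
  have "occupancy I \<tau>' c \<le> D c" if "c < Suc N" for c
    using that served served_before served_N card_P by (auto simp: less_Suc_eq occupancy_def)
  moreover have "finite P" using assms \<open>P \<subseteq> ?W\<close> by (auto simp: present_def intro: finite_subset)
  hence "card (waiting I \<beta> \<tau>' (Suc N)) = queue (occupancy I \<beta>) D (Suc N)"
    using \<open>P \<subseteq> ?W\<close> card_P card_present_N by (simp add: postponed card_Diff_subset)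
  hence "card (waiting I \<beta> \<tau>' b) = queue (occupancy I \<beta>) D b" if "b \<le> Suc N" for b
    using that queue waiting_before by (auto simp: le_Suc_eq)
  ultimately show ?case using after' by blast
qed

lemma sum_truncated_delay:
  fixes \<beta> \<tau> :: "'a \<Rightarrow> nat"
  assumes "finite I"
  shows "(\<Sum>i\<in>I. min (\<tau> i) N - \<beta> i) = (\<Sum>b=1..N. card (waiting I \<beta> \<tau> b))"
proof -
  have "card {b \<in> {1..N}. \<beta> i < b \<and> b \<le> \<tau> i} = min (\<tau> i) N - \<beta> i" for i
  proof -
    have "{b \<in> {1..N}. \<beta> i < b \<and> b \<le> \<tau> i} = {\<beta> i<..min (\<tau> i) N}" by auto
    thus ?thesis by simp
  qed
  moreover have "(\<Sum>i\<in>I. card {b \<in> {1..N}. \<beta> i < b \<and> b \<le> \<tau> i}) = (\<Sum>b=1..N. card (waiting I \<beta> \<tau> b))"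
    using assms by (intro sum_multicount_gen) (simp_all add: waiting_def)
  ultimately show ?thesis by simp
qed

lemma ex_inj_on_respecting_occupancy:
  fixes f :: "'a \<Rightarrow> nat" and g :: "'b \<Rightarrow> nat"
  assumes "finite I" "finite J" "\<And>c. occupancy I f c \<le> occupancy J g c"
  shows "\<exists>\<sigma>. inj_on \<sigma> I \<and> \<sigma> ` I \<subseteq> J \<and> (\<forall>i\<in>I. g (\<sigma> i) = f i)"
proof -
  have "\<forall>c. \<exists>h. h ` {i \<in> I. f i = c} \<subseteq> {j \<in> J. g j = c} \<and> inj_on h {i \<in> I. f i = c}"
    using assms unfolding occupancy_def by (intro allI card_le_inj) auto
  then obtain h where maps: "\<And>c. h c ` {i \<in> I. f i = c} \<subseteq> {j \<in> J. g j = c}"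
    and inj: "\<And>c. inj_on (h c) {i \<in> I. f i = c}"
    unfolding choice_iff by blast
  have in_fibre: "h (f i) i \<in> J" "g (h (f i) i) = f i" if "i \<in> I" for i
    using maps[of "f i"] that by auto
  moreover have "inj_on (\<lambda>i. h (f i) i) I"
  proof (rule inj_onI)
    fix i k assume "i \<in> I" "k \<in> I" and eq: "h (f i) i = h (f k) k"
    hence "f i = f k" using in_fibre(2) by metis
    thus "i = k" using inj_onD[OF inj[of "f k"], of i k] eq \<open>i \<in> I\<close> \<open>k \<in> I\<close> by simp
  qed
  ultimately show ?thesis by (intro exI[of _ "\<lambda>i. h (f i) i"]) auto
qed

lemma ex_inj_on_extension:
  assumes "finite I" "finite J" "card I \<le> card J" "A \<subseteq> I" "inj_on \<sigma> A" "\<sigma> ` A \<subseteq> J"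
  shows "\<exists>\<sigma>'. inj_on \<sigma>' I \<and> \<sigma>' ` I \<subseteq> J \<and> (\<forall>i\<in>A. \<sigma>' i = \<sigma> i)"
proof -
  have "finite A" using assms(1,4) finite_subset by blast
  hence "card (I - A) \<le> card (J - \<sigma> ` A)"
    using assms by (simp add: card_Diff_subset card_image)
  then obtain f where f: "f ` (I - A) \<subseteq> J - \<sigma> ` A" "inj_on f (I - A)"
    using card_le_inj[of "I - A" "J - \<sigma> ` A"] assms by auto
  let ?\<sigma>' = "\<lambda>i. if i \<in> A then \<sigma> i else f i"
  have "inj_on ?\<sigma>' (A \<union> (I - A))"
    using assms(5) f by (subst inj_on_Un) (auto simp: inj_on_def)
  hence "inj_on ?\<sigma>' I" using assms(4) by (simp add: Un_absorb1)
  moreover have "?\<sigma>' ` I \<subseteq> J" using f assms by auto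
  ultimately show ?thesis by (intro exI[of _ ?\<sigma>']) auto
qed

lemma ex_partial_matching_delay_le_queue:
  fixes I :: "'a set" and J :: "'b set" and \<beta> :: "'a \<Rightarrow> nat" and \<delta> :: "'b \<Rightarrow> nat"
  assumes "finite I" "finite J" and before: "\<And>i. i \<in> I \<Longrightarrow> \<beta> i < N"
  defines "U \<equiv> queue (occupancy I \<beta>) (occupancy J \<delta>)"
  shows "\<exists>A \<sigma>. A \<subseteq> I \<and> inj_on \<sigma> A \<and> \<sigma> ` A \<subseteq> J \<and> (\<forall>i\<in>A. \<beta> i \<le> \<delta> (\<sigma> i)) \<and>
    card (I - A) = U N \<and> (\<Sum>i\<in>A. \<delta> (\<sigma> i) - \<beta> i) \<le> (\<Sum>b=1..N. U b)"
proof -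
  obtain \<tau> where after: "\<forall>i\<in>I. \<beta> i \<le> \<tau> i" and served: "\<forall>c<N. occupancy I \<tau> c \<le> occupancy J \<delta> c"
    and queue: "\<forall>b\<le>N. card (waiting I \<beta> \<tau> b) = U b"
    unfolding U_def using ex_schedule_waiting_eq_queue[OF \<open>finite I\<close>] by blast
  define A where "A = {i \<in> I. \<tau> i < N}"
  have "A \<subseteq> I" by (auto simp: A_def)
  have "occupancy A \<tau> c \<le> occupancy J \<delta> c" for c
  proof (cases "c < N")
    case True
    hence "{i \<in> A. \<tau> i = c} = {i \<in> I. \<tau> i = c}" by (auto simp: A_def)
    thus ?thesis using served True by (simp add: occupancy_def)
  next
    case False
    hence "{i \<in> A. \<tau> i = c} = {}" by (auto simp: A_def)
    thus ?thesis unfolding occupancy_def by (simp only: card.empty zero_le)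
  qed
  then obtain \<sigma> where \<sigma>: "inj_on \<sigma> A" "\<sigma> ` A \<subseteq> J" and \<delta>_\<sigma>: "\<forall>i\<in>A. \<delta> (\<sigma> i) = \<tau> i"
    using ex_inj_on_respecting_occupancy[of A J \<tau> \<delta>] assms \<open>A \<subseteq> I\<close> finite_subset by blast
  have "I - A = waiting I \<beta> \<tau> N" using before by (auto simp: A_def waiting_def)
  hence "card (I - A) = U N" using queue by simp
  moreover have "(\<Sum>i\<in>A. \<delta> (\<sigma> i) - \<beta> i) \<le> (\<Sum>b=1..N. U b)"
  proof -
    have "(\<Sum>i\<in>A. \<delta> (\<sigma> i) - \<beta> i) = (\<Sum>i\<in>A. min (\<tau> i) N - \<beta> i)"
      using \<delta>_\<sigma> by (intro sum.cong) (auto simp: A_def)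
    also have "\<dots> \<le> (\<Sum>i\<in>I. min (\<tau> i) N - \<beta> i)"
      using \<open>finite I\<close> \<open>A \<subseteq> I\<close> by (intro sum_mono2) auto
    also have "\<dots> = (\<Sum>b=1..N. U b)"
      using queue by (simp add: sum_truncated_delay[OF \<open>finite I\<close>])
    finally show ?thesis .
  qed
  moreover have "\<forall>i\<in>A. \<beta> i \<le> \<delta> (\<sigma> i)" using after \<delta>_\<sigma> \<open>A \<subseteq> I\<close> by auto
  ultimately show ?thesis using \<open>A \<subseteq> I\<close> \<sigma> by blast
qed

section \<open>Matching points by buckets\<close>

definition bucket :: "real \<Rightarrow> real \<Rightarrow> nat" where
  "bucket w x = nat \<lfloor>x / w\<rfloor>"

lemma bucket_in_iff:
  assumes "0 < w" "0 \<le> x"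
  shows "bucket w x \<in> {a..<b} \<longleftrightarrow> x \<in> {w * a..<w * b}"
proof -
  have "a \<le> bucket w x \<longleftrightarrow> w * a \<le> x"
    using assms by (simp add: bucket_def le_nat_iff le_floor_iff field_simps)
  moreover have "bucket w x < b \<longleftrightarrow> x < w * b"
    using assms by (simp add: bucket_def nat_less_iff floor_less_iff field_simps)
  ultimately show ?thesis by simp
qed

lemma dist_le_if_bucket_le:
  assumes "0 < w" "0 \<le> x" "0 \<le> y" "bucket w x \<le> bucket w y"
  shows "\<bar>x - y\<bar> \<le> w * (real (bucket w y - bucket w x) + 1)"
proof -
  have "x \<in> {w * bucket w x..<w * (bucket w x + 1)}" "y \<in> {w * bucket w y..<w * (bucket w y + 1)}"
    using assms bucket_in_iff[of w x "bucket w x" "bucket w x + 1"]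
      bucket_in_iff[of w y "bucket w y" "bucket w y + 1"] by simp_all
  moreover have "w * bucket w x \<le> w * bucket w y"
    using assms by (intro mult_left_mono) auto
  moreover have "w * (real (bucket w y - bucket w x) + 1) = w * bucket w y - w * bucket w x + w"
    using assms(4) by (simp add: of_nat_diff algebra_simps)
  ultimately show ?thesis
    by (simp only: atLeastLessThan_iff of_nat_add of_nat_1 distrib_left mult_1_right) linarith
qed

lemma sum_dist_le_sum_bucket_delay:
  assumes "0 < w" "\<And>i. i \<in> A \<Longrightarrow> 0 \<le> x i" "\<And>i. i \<in> A \<Longrightarrow> 0 \<le> y i"
    and "\<And>i. i \<in> A \<Longrightarrow> bucket w (x i) \<le> bucket w (y i)"
  shows "(\<Sum>i\<in>A. \<bar>x i - y i\<bar>) \<le> w * (real (\<Sum>i\<in>A. bucket w (y i) - bucket w (x i)) + card A)"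
proof -
  have "(\<Sum>i\<in>A. \<bar>x i - y i\<bar>) \<le> (\<Sum>i\<in>A. w * (real (bucket w (y i) - bucket w (x i)) + 1))"
    using assms by (intro sum_mono dist_le_if_bucket_le)
  thus ?thesis by (simp add: sum.distrib flip: sum_distrib_left)
qed

lemma ex_matching_sum_dist_le_queue:
  fixes I :: "'a set" and J :: "'b set" and r :: "'a \<Rightarrow> real" and d :: "'b \<Rightarrow> real"
  assumes "finite I" "finite J" "card I \<le> card J" "0 < w"
    and r: "\<And>i. i \<in> I \<Longrightarrow> r i \<in> {0..<w * real N}"
    and d: "\<And>j. j \<in> J \<Longrightarrow> d j \<in> {0..<w * real N}"
  defines "U \<equiv> queue (occupancy I (\<lambda>i. bucket w (r i))) (occupancy J (\<lambda>j. bucket w (d j)))"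
  shows "\<exists>\<sigma>. inj_on \<sigma> I \<and> \<sigma> ` I \<subseteq> J \<and>
    (\<Sum>i\<in>I. \<bar>r i - d (\<sigma> i)\<bar>) \<le> w * (\<Sum>b=1..N. real (U b)) + w * card I + w * real N * U N"
proof -
  let ?\<beta> = "\<lambda>i. bucket w (r i)" and ?\<delta> = "\<lambda>j. bucket w (d j)"
  have "?\<beta> i < N" if "i \<in> I" for i
    using r[OF that] bucket_in_iff[OF \<open>0 < w\<close>, of "r i" 0 N] by simp
  then obtain A \<sigma> where "A \<subseteq> I" and inj: "inj_on \<sigma> A" and range: "\<sigma> ` A \<subseteq> J"
    and later: "\<forall>i\<in>A. ?\<beta> i \<le> ?\<delta> (\<sigma> i)" and unserved: "card (I - A) = U N"
    and delay: "(\<Sum>i\<in>A. ?\<delta> (\<sigma> i) - ?\<beta> i) \<le> (\<Sum>b=1..N. U b)"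
    unfolding U_def using ex_partial_matching_delay_le_queue[OF assms(1,2), of ?\<beta> N ?\<delta>] by blast
  obtain \<sigma>' where inj': "inj_on \<sigma>' I" and range': "\<sigma>' ` I \<subseteq> J" and extends: "\<forall>i\<in>A. \<sigma>' i = \<sigma> i"
    using ex_inj_on_extension[OF assms(1-3) \<open>A \<subseteq> I\<close> inj range] by blast
  have "0 \<le> r i" "0 \<le> d (\<sigma> i)" if "i \<in> A" for i
    using that \<open>A \<subseteq> I\<close> range r[of i] d[of "\<sigma> i"] by auto
  hence "(\<Sum>i\<in>A. \<bar>r i - d (\<sigma> i)\<bar>) \<le> w * (real (\<Sum>i\<in>A. ?\<delta> (\<sigma> i) - ?\<beta> i) + card A)"
    using later \<open>0 < w\<close> by (intro sum_dist_le_sum_bucket_delay) auto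
  also have "\<dots> \<le> w * (real (\<Sum>b=1..N. U b) + card I)"
    using delay card_mono[OF \<open>finite I\<close> \<open>A \<subseteq> I\<close>] \<open>0 < w\<close>
    by (intro mult_left_mono add_mono of_nat_mono) auto
  finally have served_cost:
    "(\<Sum>i\<in>A. \<bar>r i - d (\<sigma> i)\<bar>) \<le> w * (\<Sum>b=1..N. real (U b)) + w * card I"
    by (simp add: distrib_left)
  have "\<bar>r i - d (\<sigma>' i)\<bar> \<le> w * real N" if "i \<in> I - A" for i
  proof -
    have "i \<in> I" "\<sigma>' i \<in> J" using that range' by auto
    with r[of i] d[of "\<sigma>' i"] show ?thesis by auto
  qed
  hence "(\<Sum>i\<in>I - A. \<bar>r i - d (\<sigma>' i)\<bar>) \<le> (\<Sum>i\<in>I - A. w * real N)" by (intro sum_mono)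
  hence unserved_cost: "(\<Sum>i\<in>I - A. \<bar>r i - d (\<sigma>' i)\<bar>) \<le> w * real N * U N"
    by (simp add: unserved mult.commute)
  have "(\<Sum>i\<in>I. \<bar>r i - d (\<sigma>' i)\<bar>) = (\<Sum>i\<in>A. \<bar>r i - d (\<sigma> i)\<bar>) + (\<Sum>i\<in>I - A. \<bar>r i - d (\<sigma>' i)\<bar>)"
    using assms(1) \<open>A \<subseteq> I\<close> extends by (simp add: sum.subset_diff add.commute)
  also note add_mono[OF served_cost unserved_cost]
  finally show ?thesis using inj' range' by blast
qed

lemma cost_OMN_le:
  assumes "inj_on \<sigma> {1..n}" "\<sigma> ` {1..n} \<subseteq> {1..m}"
  shows "cost_OMN n m r d \<le> (\<Sum>i=1..n. \<bar>r i - d (\<sigma> i)\<bar>)"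
proof -
  have "restrict \<sigma> {1..n} \<in> matchings n m"
    using assms by (auto simp: matchings_def inj_on_restrict_eq)
  hence "cost_OMN n m r d \<le> (\<Sum>i=1..n. \<bar>r i - d (restrict \<sigma> {1..n} i)\<bar>)"
    unfolding cost_OMN_def by (intro Min_le finite_imageI finite_matchings imageI)
  thus ?thesis by simp
qed

definition market_queue :: "real \<Rightarrow> nat \<Rightarrow> nat \<Rightarrow> (nat + nat \<Rightarrow> real) \<Rightarrow> nat \<Rightarrow> nat" where
  "market_queue w n m \<omega> =
     queue (occupancy {1..n} (\<lambda>i. bucket w (\<omega> (Inl i))))
       (occupancy {1..m} (\<lambda>j. bucket w (\<omega> (Inr j))))"

lemma cost_OMN_le_market_queue:
  assumes "1 \<le> n" "n \<le> m" "0 < l" and \<omega>: "\<And>k. k \<in> {1..n} <+> {1..m} \<Longrightarrow> \<omega> k \<in> {0..<l}"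
  shows "cost_OMN n m (\<lambda>i. \<omega> (Inl i)) (\<lambda>j. \<omega> (Inr j)) \<le>
    l / n * (\<Sum>b=1..n. real (market_queue (l / n) n m \<omega> b)) + l + l * market_queue (l / n) n m \<omega> n"
proof -
  have r: "\<omega> (Inl i) \<in> {0..<l}" if "i \<in> {1..n}" for i using \<omega> that by blast
  have d: "\<omega> (Inr j) \<in> {0..<l}" if "j \<in> {1..m}" for j using \<omega> that by blast
  obtain \<sigma> where "inj_on \<sigma> {1..n}" "\<sigma> ` {1..n} \<subseteq> {1..m}"
    and cost: "(\<Sum>i=1..n. \<bar>\<omega> (Inl i) - \<omega> (Inr (\<sigma> i))\<bar>) \<le>
      l / n * (\<Sum>b=1..n. real (market_queue (l / n) n m \<omega> b)) + l / n * card {1..n} +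
      l / n * real n * market_queue (l / n) n m \<omega> n"
    using ex_matching_sum_dist_le_queue[of "{1..n}" "{1..m}" "l / n" "\<lambda>i. \<omega> (Inl i)" n
        "\<lambda>j. \<omega> (Inr j)", folded market_queue_def] assms(1-3) r d by auto
  hence "cost_OMN n m (\<lambda>i. \<omega> (Inl i)) (\<lambda>j. \<omega> (Inr j)) \<le> (\<Sum>i=1..n. \<bar>\<omega> (Inl i) - \<omega> (Inr (\<sigma> i))\<bar>)"
    by (intro cost_OMN_le)
  also note cost
  finally show ?thesis using assms(1) by simp
qed
section \<open>Coordinates of the market\<close>

lemma indep_vars_PiM_components:
  assumes "\<And>i. i \<in> I \<Longrightarrow> prob_space (M i)"
  shows "prob_space.indep_vars (Pi\<^sub>M I M) M (\<lambda>i \<omega>. \<omega> i) I"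
proof -
  interpret prob_space "Pi\<^sub>M I M" by (rule prob_space_PiM) fact
  show ?thesis
  proof (cases "I = {}")
    case True
    thus ?thesis unfolding indep_vars_def indep_sets_def by simp
  next
    case False
    have "distr (Pi\<^sub>M I M) (Pi\<^sub>M I M) (\<lambda>\<omega>. \<lambda>i\<in>I. \<omega> i) = distr (Pi\<^sub>M I M) (Pi\<^sub>M I M) (\<lambda>\<omega>. \<omega>)"
      by (intro distr_cong) (auto simp: space_PiM)
    also have "\<dots> = Pi\<^sub>M I M" by simp
    also have "\<dots> = (\<Pi>\<^sub>M i\<in>I. distr (Pi\<^sub>M I M) (M i) (\<lambda>\<omega>. \<omega> i))"
      using assms by (intro PiM_cong) (simp_all add: distr_PiM_component)
    finally show ?thesis using False by (subst indep_vars_iff_distr_eq_PiM') auto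
  qed
qed

lemma distr_market_component:
  assumes "0 < l" "k \<in> {1..n} <+> {1..m}"
  shows "distr (market l n m) borel (\<lambda>\<omega>. \<omega> k) = uniform_measure lborel {0..l}"
proof -
  let ?U = "uniform_measure lborel {0..l}"
  have "distr (market l n m) borel (\<lambda>\<omega>. \<omega> k) = distr (market l n m) ?U (\<lambda>\<omega>. \<omega> k)"
    by (intro distr_cong) auto
  also have "\<dots> = ?U"
    unfolding market_def using assms by (intro distr_PiM_component prob_space_uniform_Icc)
  finally show ?thesis .
qed

lemma measurable_market_component:
  assumes "k \<in> {1..n} <+> {1..m}"
  shows "(\<lambda>\<omega>. \<omega> k) \<in> borel_measurable (market l n m)"
  unfolding market_def using assms by simp

lemma indep_vars_market:
  assumes "0 < l"
  shows "prob_space.indep_vars (market l n m) (\<lambda>_. borel) (\<lambda>k \<omega>. \<omega> k) ({1..n} <+> {1..m})"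
proof -
  interpret prob_space "market l n m" by (rule prob_space_market[OF assms])
  have "indep_vars (\<lambda>_. uniform_measure lborel {0..l}) (\<lambda>k \<omega>. \<omega> k) ({1..n} <+> {1..m})"
    using indep_vars_PiM_components[of _ "\<lambda>_. uniform_measure lborel {0..l}"]
      prob_space_uniform_Icc[OF assms] by (simp add: market_def)
  thus ?thesis by (rule indep_vars_compose2[where Y = "\<lambda>_ x. x"]) (simp add: measurable_ident_sets)
qed

lemma AE_market_in:
  assumes "0 < l"
  shows "AE \<omega> in market l n m. \<forall>k\<in>{1..n} <+> {1..m}. \<omega> k \<in> {0..<l}"
proof -
  have "AE \<omega> in market l n m. \<omega> k \<in> {0..<l}" if k: "k \<in> {1..n} <+> {1..m}" for k
  proof -
    have "AE x in uniform_measure lborel {0..l}. x \<in> {0..<l}"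
    proof (rule AE_uniform_measureI)
      show "AE x in lborel. x \<in> {0..l} \<longrightarrow> x \<in> {0..<l}"
        using AE_lborel_singleton[of l] by eventually_elim auto
    qed simp
    thus ?thesis
      unfolding distr_market_component[OF assms k, symmetric]
      by (rule AE_distrD[OF measurable_market_component[OF k]])
  qed
  thus ?thesis by (intro AE_finite_allI) auto
qed

lemma distributed_market_component:
  assumes "0 < l" "k \<in> {1..n} <+> {1..m}"
  shows "distributed (market l n m) lborel (\<lambda>\<omega>. \<omega> k)
    (\<lambda>x. indicator {0..l} x / measure lborel {0..l})"
proof -
  have "distr (market l n m) lborel (\<lambda>\<omega>. \<omega> k) = distr (market l n m) borel (\<lambda>\<omega>. \<omega> k)"
    by (intro distr_cong) auto
  also have "\<dots> = density lborel (\<lambda>x. ennreal (indicator {0..l} x / measure lborel {0..l}))"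
    unfolding distr_market_component[OF assms] uniform_measure_def
    using assms
    by (intro density_cong) (auto simp: indicator_def divide_ennreal simp flip: ennreal_1)
  finally show ?thesis using measurable_market_component[OF assms(2)] by (simp add: distributed_def)
qed

section \<open>Unbalanced markets\<close>

lemma (in prob_space) expectation_prod_le_exp:
  fixes X :: "'i \<Rightarrow> 'a \<Rightarrow> real"
  assumes "finite I" "indep_vars (\<lambda>_. borel) X I"
    and "\<And>i. i \<in> I \<Longrightarrow> integrable M (X i)" "\<And>i \<omega>. i \<in> I \<Longrightarrow> 0 \<le> X i \<omega>"
  shows "expectation (\<lambda>\<omega>. \<Prod>i\<in>I. X i \<omega>) \<le> exp (\<Sum>i\<in>I. expectation (X i) - 1)"
proof -
  have "expectation (\<lambda>\<omega>. \<Prod>i\<in>I. X i \<omega>) = (\<Prod>i\<in>I. expectation (X i))"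
    using assms(1-3) by (rule indep_vars_lebesgue_integral)
  also have "\<dots> \<le> (\<Prod>i\<in>I. exp (expectation (X i) - 1))"
  proof (rule prod_mono)
    fix i assume "i \<in> I"
    thus "0 \<le> expectation (X i) \<and> expectation (X i) \<le> exp (expectation (X i) - 1)"
      using assms(4) exp_ge_add_one_self[of "expectation (X i) - 1"] by (simp add: integral_nonneg)
  qed
  also have "\<dots> = exp (\<Sum>i\<in>I. expectation (X i) - 1)" using assms(1) by (simp add: exp_sum)
  finally show ?thesis .
qed

lemma measurable_bucket [measurable]: "bucket w \<in> borel \<rightarrow>\<^sub>M count_space UNIV"
  unfolding bucket_def[abs_def] by measurable

lemma measure_uniform_bucket:
  fixes a b n :: nat
  assumes "0 < l" "1 \<le> n" "a \<le> b" "b \<le> n"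
  shows "measure (uniform_measure lborel {0..l}) {x. bucket (l / n) x \<in> {a..<b}} =
    (real b - real a) / n"
proof -
  have "l / n * b \<le> l" using assms by (simp add: field_simps)
  moreover have "0 \<le> l / n * a" using assms by simp
  ultimately have "{l / n * a..<l / n * b} \<subseteq> {0..l}" by auto
  moreover have "bucket (l / n) x \<in> {a..<b} \<longleftrightarrow> x \<in> {l / n * a..<l / n * b}" if "x \<in> {0..l}" for x
    using that assms by (intro bucket_in_iff) auto
  ultimately have "{0..l} \<inter> {x. bucket (l / n) x \<in> {a..<b}} = {l / n * a..<l / n * b}" by blast
  moreover have "l / n * a \<le> l / n * b" using assms by (intro mult_left_mono) auto
  ultimately show ?thesis
    using assms by (simp add: measure_uniform_measure field_simps)
qed

definition bucket_weight :: "real \<Rightarrow> real \<Rightarrow> nat \<Rightarrow> nat \<Rightarrow> nat + nat \<Rightarrow> real \<Rightarrow> real" where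
  "bucket_weight z w a b k x =
     (if bucket w x \<in> {a..<b} then case k of Inl _ \<Rightarrow> z | Inr _ \<Rightarrow> 1 / z else 1)"

lemma measurable_bucket_weight [measurable]: "bucket_weight z w a b k \<in> borel_measurable borel"
  using measurable_compose[OF measurable_bucket,
      of "\<lambda>c. if c \<in> {a..<b} then case k of Inl _ \<Rightarrow> z | Inr _ \<Rightarrow> 1 / z else 1" borel w]
  by (simp add: bucket_weight_def[abs_def])

lemma market_queue_le_sum_bucket_weight:
  assumes "1 < z"
  shows "real (market_queue w n m \<omega> b) \<le>
    (\<Sum>a<b. \<Prod>k\<in>{1..n} <+> {1..m}. bucket_weight z w a b k (\<omega> k)) / (z - 1)"
  using queue_le_sum_power[OF assms, of "occupancy {1..n} (\<lambda>i. bucket w (\<omega> (Inl i)))"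
      "occupancy {1..m} (\<lambda>j. bucket w (\<omega> (Inr j)))" b]
  by (simp only: market_queue_def power_sum_occupancy finite_atLeastAtMost finite_atLeastLessThan
      prod.Plus bucket_weight_def sum.case comp_def)

lemma integrable_bucket_weight:
  assumes "0 < l" "1 < z" and k: "k \<in> {1..n} <+> {1..m}"
  shows "integrable (market l n m) (\<lambda>\<omega>. bucket_weight z w a b k (\<omega> k))"
proof -
  interpret prob_space "market l n m" by (rule prob_space_market) fact
  have "1 / z \<le> z" using \<open>1 < z\<close> by (simp add: order_trans[of _ 1])
  hence "norm (bucket_weight z w a b k x) \<le> z" for x
    using \<open>1 < z\<close> by (simp add: bucket_weight_def split: sum.split)
  thus ?thesis
    using measurable_market_component[OF k] by (intro integrable_const_bound[where B = z]) auto
qed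

lemma expectation_bucket_weight:
  fixes a b n :: nat
  assumes "0 < l" "1 \<le> n" "a \<le> b" "b \<le> n" and k: "k \<in> {1..n} <+> {1..m}"
  shows "(\<integral>\<omega>. bucket_weight z (l / n) a b k (\<omega> k) \<partial>market l n m) =
    1 + (real b - real a) / n * ((case k of Inl _ \<Rightarrow> z | Inr _ \<Rightarrow> 1 / z) - 1)"
proof -
  let ?U = "uniform_measure lborel {0..l}" and ?A = "{x. bucket (l / n) x \<in> {a..<b}}"
  let ?c = "case k of Inl _ \<Rightarrow> z | Inr _ \<Rightarrow> 1 / z"
  interpret prob_space ?U by (rule prob_space_uniform_Icc) fact
  have "(\<integral>\<omega>. bucket_weight z (l / n) a b k (\<omega> k) \<partial>market l n m) =
      (\<integral>x. bucket_weight z (l / n) a b k x \<partial>?U)"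
    unfolding distr_market_component[OF \<open>0 < l\<close> k, symmetric]
    using measurable_market_component[OF k] by (subst integral_distr) auto
  also have "\<dots> = (\<integral>x. 1 + indicator ?A x * (?c - 1) \<partial>?U)"
    by (intro Bochner_Integration.integral_cong) (auto simp: bucket_weight_def indicator_def)
  also have "\<dots> = 1 + measure ?U ?A * (?c - 1)"
    using prob_space by (simp add: emeasure_eq_measure)
  also have "measure ?U ?A = (real b - real a) / n"
    using assms(1-4) by (rule measure_uniform_bucket)
  finally show ?thesis .
qed

lemma indep_vars_bucket_weight:
  assumes "0 < l"
  shows "prob_space.indep_vars (market l n m) (\<lambda>_. borel)
    (\<lambda>k \<omega>. bucket_weight z w a b k (\<omega> k)) ({1..n} <+> {1..m})"
  using prob_space_market[OF assms] indep_vars_market[OF assms]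
  by (rule prob_space.indep_vars_compose2) simp

lemma integrable_prod_bucket_weight:
  assumes "0 < l" "1 < z"
  shows "integrable (market l n m) (\<lambda>\<omega>. \<Prod>k\<in>{1..n} <+> {1..m}. bucket_weight z w a b k (\<omega> k))"
  using integrable_bucket_weight[OF assms] indep_vars_bucket_weight[OF assms(1)]
  by (intro prob_space.indep_vars_integrable[OF prob_space_market[OF assms(1)]]) auto

lemma expectation_prod_bucket_weight_le:
  fixes a b n m :: nat and \<epsilon> :: real
  assumes "0 < l" "1 \<le> n" "a \<le> b" "b \<le> n" "1 < z" "(1 + \<epsilon>) * n \<le> m"
  shows "(\<integral>\<omega>. (\<Prod>k\<in>{1..n} <+> {1..m}. bucket_weight z (l / n) a b k (\<omega> k)) \<partial>market l n m) \<le>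
    exp (- ((z - 1) * (1 + \<epsilon> - z) / z) * (real b - real a))"
proof -
  interpret prob_space "market l n m" by (rule prob_space_market) fact
  let ?K = "{1..n} <+> {1..m}" and ?weight = "\<lambda>k \<omega>. bucket_weight z (l / n) a b k (\<omega> k)"
  define p where "p = (real b - real a) / n"
  have "0 \<le> p" using \<open>a \<le> b\<close> by (simp add: p_def)
  have "expectation (\<lambda>\<omega>. \<Prod>k\<in>?K. ?weight k \<omega>) \<le> exp (\<Sum>k\<in>?K. expectation (?weight k) - 1)"
  proof (rule expectation_prod_le_exp)
    show "0 \<le> ?weight k \<omega>" for k \<omega>
      using \<open>1 < z\<close> by (simp add: bucket_weight_def split: sum.split)
  qed (use assms integrable_bucket_weight indep_vars_bucket_weight in \<open>simp_all del: One_nat_def\<close>)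
  also have "(\<Sum>k\<in>?K. expectation (?weight k) - 1) =
      (\<Sum>k\<in>?K. p * ((case k of Inl _ \<Rightarrow> z | Inr _ \<Rightarrow> 1 / z) - 1))"
    using assms by (intro sum.cong refl) (simp add: expectation_bucket_weight p_def)
  also have "\<dots> = p * (z - 1) * n - p * (1 - 1 / z) * m"
    by (simp add: sum.Plus algebra_simps)
  also have "\<dots> \<le> p * (z - 1) * n - p * (1 - 1 / z) * ((1 + \<epsilon>) * n)"
    using \<open>0 \<le> p\<close> assms by (intro diff_left_mono mult_left_mono) auto
  also have "\<dots> = - ((z - 1) * (1 + \<epsilon> - z) / z) * (p * n)"
    using \<open>1 < z\<close> by (simp add: field_simps)
  also have "p * n = real b - real a" using \<open>1 \<le> n\<close> by (simp add: p_def)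
  finally show ?thesis by simp
qed

lemma sum_exp_minus_le:
  fixes \<kappa> :: real
  assumes "0 < \<kappa>"
  shows "(\<Sum>a<b. exp (- \<kappa> * (real b - real a))) \<le> 1 / \<kappa>"
proof (induction b)
  case 0
  show ?case using assms by simp
next
  case (Suc b)
  have "(\<Sum>a<Suc b. exp (- \<kappa> * (real (Suc b) - real a))) =
      exp (- \<kappa>) * ((\<Sum>a<b. exp (- \<kappa> * (real b - real a))) + 1)"
    by (simp add: sum_distrib_left distrib_left algebra_simps flip: exp_add)
  also have "\<dots> \<le> exp (- \<kappa>) * (1 / \<kappa> + 1)"
    using Suc.IH by (intro mult_left_mono add_mono) auto
  also have "1 / \<kappa> + 1 = (1 + \<kappa>) / \<kappa>" using assms by (simp add: add_divide_distrib)
  also have "exp (- \<kappa>) * \<dots> \<le> exp (- \<kappa>) * (exp \<kappa> / \<kappa>)"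
    using assms by (intro mult_left_mono divide_right_mono) auto
  also have "\<dots> = 1 / \<kappa>" by (simp add: exp_minus)
  finally show ?case .
qed

lemma measurable_market_queue [measurable]:
  "(\<lambda>\<omega>. market_queue w n m \<omega> b) \<in> market l n m \<rightarrow>\<^sub>M count_space UNIV"
proof -
  have occupancy_eq: "occupancy {1..n} \<beta> c = (\<Sum>i=1..n. if \<beta> i = c then 1 else 0)"
    for \<beta> c and n :: nat
    by (simp add: occupancy_def sum.If_cases Int_def)
  have [measurable]:
    "i \<in> {1..n} \<Longrightarrow> (\<lambda>\<omega>. \<omega> (Inl i)) \<in> borel_measurable (market l n m)"
    "j \<in> {1..m} \<Longrightarrow> (\<lambda>\<omega>. \<omega> (Inr j)) \<in> borel_measurable (market l n m)" for i j
    by (auto intro: measurable_market_component)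
  have [measurable]:
    "(\<lambda>\<omega>. occupancy {1..n} (\<lambda>i. bucket w (\<omega> (Inl i))) c) \<in> market l n m \<rightarrow>\<^sub>M count_space UNIV"
    "(\<lambda>\<omega>. occupancy {1..m} (\<lambda>j. bucket w (\<omega> (Inr j))) c) \<in> market l n m \<rightarrow>\<^sub>M count_space UNIV" for c
    unfolding occupancy_eq by measurable
  show ?thesis
    unfolding market_queue_def by (induction b) (simp_all del: One_nat_def)
qed

lemma integrable_market_queue:
  assumes "0 < l" "1 \<le> n" "b \<le> n"
  shows "integrable (market l n m) (\<lambda>\<omega>. real (market_queue (l / n) n m \<omega> b))"
proof (rule Bochner_Integration.integrable_bound)
  show "integrable (market l n m)
      (\<lambda>\<omega>. \<Sum>a<b. \<Prod>k\<in>{1..n} <+> {1..m}. bucket_weight 2 (l / n) a b k (\<omega> k))"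
    using assms by (intro Bochner_Integration.integrable_sum integrable_prod_bucket_weight) auto
  show "AE \<omega> in market l n m. norm (real (market_queue (l / n) n m \<omega> b)) \<le>
      norm (\<Sum>a<b. \<Prod>k\<in>{1..n} <+> {1..m}. bucket_weight 2 (l / n) a b k (\<omega> k))"
    using market_queue_le_sum_bucket_weight[of 2]
    by (intro AE_I2) (simp add: order_trans[OF _ abs_ge_self])
qed measurable

lemma expectation_market_queue_le:
  assumes "0 < l" "1 \<le> n" "b \<le> n" "1 < z" "z < 1 + \<epsilon>" "(1 + \<epsilon>) * n \<le> m"
  shows "(\<integral>\<omega>. real (market_queue (l / n) n m \<omega> b) \<partial>market l n m) \<le> z / ((z - 1)\<^sup>2 * (1 + \<epsilon> - z))"
proof -
  let ?weight = "\<lambda>a \<omega>. \<Prod>k\<in>{1..n} <+> {1..m}. bucket_weight z (l / n) a b k (\<omega> k)"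
  define \<kappa> where "\<kappa> = (z - 1) * (1 + \<epsilon> - z) / z"
  have "0 < \<kappa>" using assms by (simp add: \<kappa>_def)
  have weight: "integrable (market l n m) (?weight a)"
    "integral\<^sup>L (market l n m) (?weight a) \<le> exp (- \<kappa> * (real b - real a))" if "a < b" for a
    unfolding \<kappa>_def using assms that
    by (intro integrable_prod_bucket_weight expectation_prod_bucket_weight_le; simp)+
  have "(\<integral>\<omega>. real (market_queue (l / n) n m \<omega> b) \<partial>market l n m) \<le>
      (\<integral>\<omega>. (\<Sum>a<b. ?weight a \<omega>) / (z - 1) \<partial>market l n m)"
    using assms weight(1) market_queue_le_sum_bucket_weight
    by (intro integral_mono integrable_market_queue integrable_divide
        Bochner_Integration.integrable_sum) auto
  also have "\<dots> = (\<Sum>a<b. integral\<^sup>L (market l n m) (?weight a)) / (z - 1)"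
    using weight(1) by simp
  also have "\<dots> \<le> (\<Sum>a<b. exp (- \<kappa> * (real b - real a))) / (z - 1)"
    using weight(2) \<open>1 < z\<close> by (intro divide_right_mono sum_mono) auto
  also have "\<dots> \<le> 1 / \<kappa> / (z - 1)"
    using sum_exp_minus_le[OF \<open>0 < \<kappa>\<close>] \<open>1 < z\<close> by (intro divide_right_mono) auto
  also have "\<dots> = z / ((z - 1)\<^sup>2 * (1 + \<epsilon> - z))"
    by (simp add: \<kappa>_def power2_eq_square)
  finally show ?thesis .
qed

lemma expected_cost_OMN_le_if_queue_le:
  assumes "1 \<le> n" "n \<le> m" "0 < l"
    and queue_le: "\<And>b. b \<le> n \<Longrightarrow> (\<integral>\<omega>. real (market_queue (l / n) n m \<omega> b) \<partial>market l n m) \<le> K"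
  shows "expected_cost_OMN l n m \<le> (1 + 2 * K) * l"
proof -
  interpret prob_space "market l n m" by (rule prob_space_market) fact
  let ?U = "\<lambda>b \<omega>. real (market_queue (l / n) n m \<omega> b)"
  have integrable: "integrable (market l n m) (?U b)" if "b \<le> n" for b
    using assms that by (intro integrable_market_queue)
  hence integrable_sum: "integrable (market l n m) (\<lambda>\<omega>. \<Sum>b=1..n. ?U b \<omega>)"
    by (intro Bochner_Integration.integrable_sum) auto
  have "expected_cost_OMN l n m \<le> expectation (\<lambda>\<omega>. l / n * (\<Sum>b=1..n. ?U b \<omega>) + l + l * ?U n \<omega>)"
    unfolding expected_cost_OMN_def
  proof (rule integral_mono_AE)
    show "AE \<omega> in market l n m. cost_OMN n m (\<lambda>i. \<omega> (Inl i)) (\<lambda>j. \<omega> (Inr j)) \<le>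
        l / n * (\<Sum>b=1..n. ?U b \<omega>) + l + l * ?U n \<omega>"
      using AE_market_in[OF \<open>0 < l\<close>]
      by eventually_elim (use assms in \<open>intro cost_OMN_le_market_queue, auto\<close>)
  qed (use assms integrable integrable_sum integrable_cost_OMN in auto)
  also have "\<dots> = l / n * expectation (\<lambda>\<omega>. \<Sum>b=1..n. ?U b \<omega>) + l + l * expectation (?U n)"
    using integrable integrable_sum by (simp add: prob_space del: Bochner_Integration.integral_sum)
  also have "\<dots> = l / n * (\<Sum>b=1..n. expectation (?U b)) + l + l * expectation (?U n)"
    using integrable by (subst Bochner_Integration.integral_sum) auto
  also have "\<dots> \<le> l / n * (\<Sum>b=1..n. K) + l + l * K"
    using assms by (intro add_mono mult_left_mono sum_mono queue_le) auto
  also have "\<dots> = (1 + 2 * K) * l"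
    using assms by (simp add: algebra_simps)
  finally show ?thesis .
qed

lemma expected_cost_OMN_le:
  fixes \<epsilon> :: real
  assumes "1 \<le> n" "n \<le> m" "0 < l" "0 < \<epsilon>" "(1 + \<epsilon>) * n \<le> m"
  shows "expected_cost_OMN l n m \<le> (1 + 8 * (2 + \<epsilon>) / \<epsilon> ^ 3) * l"
proof -
  let ?z = "1 + \<epsilon> / 2"
  have "(\<integral>\<omega>. real (market_queue (l / n) n m \<omega> b) \<partial>market l n m) \<le>
      ?z / ((?z - 1)\<^sup>2 * (1 + \<epsilon> - ?z))" if "b \<le> n" for b
    using assms that by (intro expectation_market_queue_le) auto
  also have "?z / ((?z - 1)\<^sup>2 * (1 + \<epsilon> - ?z)) = 4 * (2 + \<epsilon>) / \<epsilon> ^ 3"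
    using assms by (simp add: field_simps power2_eq_square power3_eq_cube)
  finally have "(\<integral>\<omega>. real (market_queue (l / n) n m \<omega> b) \<partial>market l n m) \<le> 4 * (2 + \<epsilon>) / \<epsilon> ^ 3"
    if "b \<le> n" for b using that by blast
  from expected_cost_OMN_le_if_queue_le[OF assms(1-3) this] show ?thesis by simp
qed

section \<open>Balanced markets\<close>

lemma abs_sum_diff_le_cost_OMN: "\<bar>(\<Sum>i=1..n. r i) - (\<Sum>j=1..n. d j)\<bar> \<le> cost_OMN n n r d"
proof -
  have "cost_OMN n n r d \<in> (\<lambda>\<sigma>. \<Sum>i=1..n. \<bar>r i - d (\<sigma> i)\<bar>) ` matchings n n"
    unfolding cost_OMN_def using finite_matchings matchings_nonempty[of n n] by (intro Min_in) auto
  then obtain \<sigma> where "\<sigma> \<in> matchings n n"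
    and cost_eq: "cost_OMN n n r d = (\<Sum>i=1..n. \<bar>r i - d (\<sigma> i)\<bar>)" by blast
  hence inj: "inj_on \<sigma> {1..n}" "\<sigma> ` {1..n} \<subseteq> {1..n}" by (auto simp: matchings_def)
  have "\<sigma> ` {1..n} = {1..n}" using endo_inj_surj[OF _ inj(2,1)] by simp
  hence "(\<Sum>j=1..n. d j) = (\<Sum>i=1..n. d (\<sigma> i))"
    using sum.reindex[OF inj(1), of d] by simp
  thus ?thesis by (simp add: cost_eq flip: sum_subtractf)
qed

lemma (in prob_space) one_minus_cmod_char_le:
  fixes X :: "'a \<Rightarrow> real"
  assumes "integrable M X"
  shows "1 - cmod (char (distr M borel X) t) \<le> \<bar>t\<bar> * expectation (\<lambda>\<omega>. \<bar>X \<omega>\<bar>)"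
proof -
  have [measurable]: "random_variable borel X" using assms by simp
  interpret X: real_distribution "distr M borel X" by (rule real_distribution_distr) simp
  have "1 - cmod (char (distr M borel X) t) \<le> cmod (char (distr M borel X) t - 1)"
    using norm_triangle_ineq2[of 1 "char (distr M borel X) t"] by (simp add: norm_minus_commute)
  also have "\<dots> \<le> X.expectation (\<lambda>x. min 2 (\<bar>t\<bar> * \<bar>x\<bar>))"
    using X.char_approx2[of 0 t] X.prob_space by simp
  also have "\<dots> = expectation (\<lambda>\<omega>. min 2 (\<bar>t\<bar> * \<bar>X \<omega>\<bar>))"
    by (rule integral_distr) auto
  also have "\<dots> \<le> expectation (\<lambda>\<omega>. \<bar>t\<bar> * \<bar>X \<omega>\<bar>)"
    using assms by (intro integral_mono) auto
  finally show ?thesis by simp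
qed

lemma (in prob_space) cmod_char_minus_quadratic_le:
  fixes X :: "'a \<Rightarrow> real"
  assumes X: "random_variable borel X" "integrable M (\<lambda>\<omega>. (X \<omega>)\<^sup>2)" "expectation X = 0"
    and bounded: "AE \<omega> in M. \<bar>t * X \<omega>\<bar> \<le> 1"
  shows "cmod (char (distr M borel X) t - (1 - t\<^sup>2 * variance X / 2)) \<le> t\<^sup>2 * variance X / 6"
proof -
  let ?remainder = "\<lambda>\<omega>. min (6 * (X \<omega>)\<^sup>2) (\<bar>t\<bar> * \<bar>X \<omega>\<bar> ^ 3)"
  have [measurable]: "random_variable borel X" by fact
  have "expectation ?remainder \<le> expectation (\<lambda>\<omega>. (X \<omega>)\<^sup>2)"
  proof (intro integral_mono_AE)
    show "integrable M ?remainder"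
      by (rule Bochner_Integration.integrable_bound[OF integrable_mult_right[OF X(2), of 6]]) auto
    show "AE \<omega> in M. ?remainder \<omega> \<le> (X \<omega>)\<^sup>2"
      using bounded
    proof eventually_elim
      case (elim \<omega>)
      have "\<bar>t\<bar> * \<bar>X \<omega>\<bar> ^ 3 = \<bar>t * X \<omega>\<bar> * (X \<omega>)\<^sup>2"
        by (simp add: abs_mult power3_eq_cube power2_eq_square)
      also have "\<dots> \<le> 1 * (X \<omega>)\<^sup>2" using elim by (intro mult_right_mono) auto
      finally show ?case by simp
    qed
  qed (rule X(2))
  hence "t\<^sup>2 / 6 * expectation ?remainder \<le> t\<^sup>2 * variance X / 6"
    by (simp add: X(3) mult_left_mono)
  moreover have "cmod (char (distr M borel X) t - (1 - t\<^sup>2 * variance X / 2)) \<le>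
      t\<^sup>2 / 6 * expectation ?remainder"
    using square_integrable_imp_integrable[OF X(1,2)] X by (intro char_approx3') auto
  ultimately show ?thesis by linarith
qed

lemma (in prob_space) cmod_char_le_exp_variance:
  fixes X :: "'a \<Rightarrow> real"
  assumes X: "random_variable borel X" "integrable M (\<lambda>\<omega>. (X \<omega>)\<^sup>2)" "expectation X = 0"
    and bounded: "AE \<omega> in M. \<bar>t * X \<omega>\<bar> \<le> 1"
  shows "cmod (char (distr M borel X) t) \<le> exp (- (t\<^sup>2 * variance X / 3))"
proof -
  have "t\<^sup>2 * variance X = expectation (\<lambda>\<omega>. (t * X \<omega>)\<^sup>2)"
    by (simp add: X(3) power_mult_distrib)
  also have "\<dots> \<le> expectation (\<lambda>_. 1)"
  proof (rule integral_mono_AE)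
    show "AE \<omega> in M. (t * X \<omega>)\<^sup>2 \<le> 1" using bounded by (simp add: abs_square_le_1)
  qed (use X(2) in \<open>simp_all add: power_mult_distrib\<close>)
  finally have "t\<^sup>2 * variance X \<le> 1" by (simp add: prob_space)
  hence "cmod (1 - t\<^sup>2 * variance X / 2) = 1 - t\<^sup>2 * variance X / 2"
    using norm_of_real[of "1 - t\<^sup>2 * variance X / 2", where 'a = complex] by simp
  hence "cmod (char (distr M borel X) t) \<le> 1 - t\<^sup>2 * variance X / 2 + t\<^sup>2 * variance X / 6"
    using cmod_char_minus_quadratic_le[OF assms]
      norm_triangle_sub[of "char (distr M borel X) t" "1 - t\<^sup>2 * variance X / 2"] by simp
  also have "\<dots> \<le> exp (- (t\<^sup>2 * variance X / 3))"
    using exp_ge_add_one_self[of "- (t\<^sup>2 * variance X / 3)"] by simp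
  finally show ?thesis .
qed

lemma (in prob_space) expectation_abs_sum_ge:
  fixes X :: "'i \<Rightarrow> 'a \<Rightarrow> real"
  assumes indep: "indep_vars (\<lambda>_. borel) X I"
    and bounded: "\<And>i. i \<in> I \<Longrightarrow> AE \<omega> in M. \<bar>X i \<omega>\<bar> \<le> B"
    and mean: "\<And>i. i \<in> I \<Longrightarrow> expectation (X i) = 0" and t: "0 < t" "t * B \<le> 1"
  shows "(1 - exp (- (t\<^sup>2 / 3 * (\<Sum>i\<in>I. variance (X i))))) / t \<le> expectation (\<lambda>\<omega>. \<bar>\<Sum>i\<in>I. X i \<omega>\<bar>)"
proof -
  let ?S = "\<lambda>\<omega>. \<Sum>i\<in>I. X i \<omega>"
  have measurable: "random_variable borel (X i)" if "i \<in> I" for i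
    using indep that by (simp add: indep_vars_def)
  have integrable: "integrable M (X i)" "integrable M (\<lambda>\<omega>. (X i \<omega>)\<^sup>2)" if "i \<in> I" for i
  proof -
    show "integrable M (X i)"
      using bounded[OF that] measurable[OF that] by (intro integrable_const_bound[where B = B]) auto
    have "AE \<omega> in M. \<bar>(X i \<omega>)\<^sup>2\<bar> \<le> B\<^sup>2"
      using bounded[OF that] by eventually_elim (metis abs_power2 abs_ge_zero power2_abs power_mono)
    thus "integrable M (\<lambda>\<omega>. (X i \<omega>)\<^sup>2)"
      using measurable[OF that] by (intro integrable_const_bound[where B = "B\<^sup>2"]) auto
  qed
  have bounded_scaled: "AE \<omega> in M. \<bar>t * X i \<omega>\<bar> \<le> 1" if "i \<in> I" for i
    using bounded[OF that]
  proof eventually_elim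
    case (elim \<omega>)
    have "\<bar>t * X i \<omega>\<bar> \<le> t * B" using elim t by (simp add: abs_mult)
    thus ?case using t by simp
  qed
  have "cmod (char (distr M borel ?S) t) = (\<Prod>i\<in>I. cmod (char (distr M borel (X i)) t))"
    by (simp add: char_distr_sum[OF indep] prod_norm)
  also have "\<dots> \<le> (\<Prod>i\<in>I. exp (- (t\<^sup>2 * variance (X i) / 3)))"
    using measurable integrable bounded_scaled mean
    by (intro prod_mono conjI cmod_char_le_exp_variance) auto
  also have "\<dots> = exp (- (t\<^sup>2 / 3 * (\<Sum>i\<in>I. variance (X i))))"
    by (cases "finite I") (simp_all add: exp_sum sum_distrib_left flip: sum_negf)
  finally have "1 - exp (- (t\<^sup>2 / 3 * (\<Sum>i\<in>I. variance (X i)))) \<le>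
      1 - cmod (char (distr M borel ?S) t)"
    by simp
  also have "\<dots> \<le> t * expectation (\<lambda>\<omega>. \<bar>?S \<omega>\<bar>)"
    using one_minus_cmod_char_le[of ?S t] integrable(1) t by simp
  finally show ?thesis using t by (simp add: divide_le_eq mult.commute)
qed

definition signed_deviation :: "real \<Rightarrow> nat + nat \<Rightarrow> real \<Rightarrow> real" where
  "signed_deviation l k x = (case k of Inl _ \<Rightarrow> x - l / 2 | Inr _ \<Rightarrow> l / 2 - x)"

lemma sum_signed_deviation:
  "(\<Sum>k\<in>{1..n} <+> {1..n}. signed_deviation l k (\<omega> k)) = (\<Sum>i=1..n. \<omega> (Inl i)) - (\<Sum>j=1..n. \<omega> (Inr j))"
  by (simp add: signed_deviation_def sum.Plus sum_subtractf)

lemma measurable_signed_deviation [measurable]: "signed_deviation l k \<in> borel_measurable borel"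
  unfolding signed_deviation_def[abs_def] by (cases k) simp_all

lemma
  fixes l :: real
  assumes l: "0 < l" and k: "k \<in> {1..n} <+> {1..m}"
  shows AE_signed_deviation_le: "AE \<omega> in market l n m. \<bar>signed_deviation l k (\<omega> k)\<bar> \<le> l / 2"
    and expectation_signed_deviation: "(\<integral>\<omega>. signed_deviation l k (\<omega> k) \<partial>market l n m) = 0"
    and variance_signed_deviation:
      "prob_space.variance (market l n m) (\<lambda>\<omega>. signed_deviation l k (\<omega> k)) = l\<^sup>2 / 12"
proof -
  interpret prob_space "market l n m" by (rule prob_space_market[OF l])
  have in_interval: "AE \<omega> in market l n m. \<omega> k \<in> {0..<l}"
    using AE_market_in[OF l] by eventually_elim (use k in blast)
  thus "AE \<omega> in market l n m. \<bar>signed_deviation l k (\<omega> k)\<bar> \<le> l / 2"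
    by eventually_elim (auto simp: signed_deviation_def abs_if split: sum.split)
  have integrable: "integrable (market l n m) (\<lambda>\<omega>. \<omega> k)"
    using in_interval measurable_market_component[OF k]
    by (intro integrable_const_bound[where B = l]) auto
  note uniform = distributed_market_component[OF l k]
  have mean: "expectation (\<lambda>\<omega>. \<omega> k) = l / 2"
    using uniform_distributed_expectation[OF uniform] by simp
  show deviation_mean: "expectation (\<lambda>\<omega>. signed_deviation l k (\<omega> k)) = 0"
    using integrable mean by (cases k) (simp_all add: signed_deviation_def prob_space)
  have "variance (\<lambda>\<omega>. \<omega> k) = l\<^sup>2 / 12"
    using uniform_distributed_variance[OF uniform] by simp
  moreover have "(signed_deviation l k x)\<^sup>2 = (x - l / 2)\<^sup>2" for x
    by (simp add: signed_deviation_def power2_commute split: sum.split)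
  ultimately show "variance (\<lambda>\<omega>. signed_deviation l k (\<omega> k)) = l\<^sup>2 / 12"
    by (simp add: deviation_mean mean)
qed

lemma expected_cost_OMN_ge:
  assumes "1 \<le> n" "0 < l"
  shows "(1 - exp (- 2 / 9)) / 2 * l * sqrt n \<le> expected_cost_OMN l n n"
proof -
  interpret prob_space "market l n n" by (rule prob_space_market) fact
  let ?K = "{1..n} <+> {1..n}" and ?X = "\<lambda>k \<omega>. signed_deviation l k (\<omega> k)"
  define t where "t = 2 / (l * sqrt n)"
  have "0 < t" "t * (l / 2) \<le> 1" using assms by (auto simp: t_def)
  have indep: "indep_vars (\<lambda>_. borel) ?X ?K"
    using indep_vars_market[OF \<open>0 < l\<close>] by (rule indep_vars_compose2) simp
  have "(\<Sum>k\<in>?K. variance (?X k)) = (\<Sum>k\<in>?K. l\<^sup>2 / 12)"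
    using \<open>0 < l\<close> by (intro sum.cong variance_signed_deviation) auto
  also have "\<dots> = n * l\<^sup>2 / 6" by (simp add: card_Plus)
  finally have "t\<^sup>2 / 3 * (\<Sum>k\<in>?K. variance (?X k)) = t\<^sup>2 / 3 * (n * l\<^sup>2 / 6)" by (rule arg_cong)
  also have "\<dots> = 2 / 9" using assms by (simp add: t_def power_divide power_mult_distrib)
  finally have "t\<^sup>2 / 3 * (\<Sum>k\<in>?K. variance (?X k)) = 2 / 9" .
  hence "(1 - exp (- 2 / 9)) / 2 * l * sqrt n =
      (1 - exp (- (t\<^sup>2 / 3 * (\<Sum>k\<in>?K. variance (?X k))))) / t"
    by (simp add: t_def)
  also have "\<dots> \<le> expectation (\<lambda>\<omega>. \<bar>\<Sum>k\<in>?K. ?X k \<omega>\<bar>)"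
    using indep AE_signed_deviation_le[OF \<open>0 < l\<close>] expectation_signed_deviation[OF \<open>0 < l\<close>]
      \<open>0 < t\<close> \<open>t * (l / 2) \<le> 1\<close>
    by (rule expectation_abs_sum_ge)
  also have "\<dots> \<le> expected_cost_OMN l n n"
    unfolding expected_cost_OMN_def
  proof (rule Bochner_Integration.integral_mono')
    show "integrable (market l n n) (\<lambda>\<omega>. cost_OMN n n (\<lambda>i. \<omega> (Inl i)) (\<lambda>j. \<omega> (Inr j)))"
      using assms by (intro integrable_cost_OMN) auto
    fix \<omega> :: "nat + nat \<Rightarrow> real"
    show "\<bar>\<Sum>k\<in>?K. ?X k \<omega>\<bar> \<le> cost_OMN n n (\<lambda>i. \<omega> (Inl i)) (\<lambda>j. \<omega> (Inr j))"
      unfolding sum_signed_deviation by (rule abs_sum_diff_le_cost_OMN)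
    thus "0 \<le> cost_OMN n n (\<lambda>i. \<omega> (Inl i)) (\<lambda>j. \<omega> (Inr j))"
      by (rule order_trans[OF abs_ge_zero])
  qed
  finally show ?thesis .
qed

theorem theorem1:
  shows "(\<exists>C>0. \<forall>(n::nat) (m::nat) (l::real).
            1 \<le> n \<and> m = n \<and> 0 < l \<longrightarrow> expected_cost_OMN l n m \<ge> C * l * sqrt (real n))
       \<and> (\<forall>\<epsilon>::real. 0 < \<epsilon> \<longrightarrow>
            (\<exists>C>0. \<forall>(n::nat) (m::nat) (l::real).
               1 \<le> n \<and> n \<le> m \<and> 0 < l \<and> real n \<ge> 4 / \<epsilon> \<and> real m \<ge> (1 + \<epsilon>) * real n
                 \<longrightarrow> expected_cost_OMN l n m \<le> C * l))"
proof (intro conjI allI impI)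
  show "\<exists>C>0. \<forall>(n::nat) (m::nat) (l::real).
      1 \<le> n \<and> m = n \<and> 0 < l \<longrightarrow> expected_cost_OMN l n m \<ge> C * l * sqrt (real n)"
    using expected_cost_OMN_ge by (intro exI[of _ "(1 - exp (- 2 / 9)) / 2"]) auto
next
  fix \<epsilon> :: real
  assume "0 < \<epsilon>"
  thus "\<exists>C>0. \<forall>(n::nat) (m::nat) (l::real).
      1 \<le> n \<and> n \<le> m \<and> 0 < l \<and> real n \<ge> 4 / \<epsilon> \<and> real m \<ge> (1 + \<epsilon>) * real n
        \<longrightarrow> expected_cost_OMN l n m \<le> C * l"
    using expected_cost_OMN_le
    by (intro exI[of _ "1 + 8 * (2 + \<epsilon>) / \<epsilon> ^ 3"]) (auto intro: add_pos_nonneg)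
qed

end
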